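(* Let $A$ be a left brace of cardinality $p_1^{\alpha(1)}\cdots p_n^{\alpha(n)}$ for some $n$, some prime numbers $p_1<p_2<\cdots<p_n$ and some positive integers $\alpha(1),\ldots,\alpha(n)$. Let $A_i$ denote the Sylow subgroup of the additive group of $A$ of cardinality $p_i^{\alpha(i)}$ (which is itself a left brace under the operations of $A$). Suppose that for some $m\le n$ the brace $A_m$ has a nonzero socle and $p_m$ does not divide $p_j^i-1$ for all $j\le n$ and all $1\le i\le\alpha(j)$. Then the socle of $A$ is nonzero.
   Context: A left brace is an abelian group $(A,+)$ with a multiplication $\cdot$ such that $a\cdot(b+c)=a\cdot b+a\cdot c$ for all $a,b,c\in A$ and such that the circle operation $a\circ b=a\cdot b+a+b$ makes $A$ into a group (with identity $0$). The socle of a left brace $B$ is $\mathrm{Soc}(B)=\{a\in B: a\cdot b=0 \text{ for all } b\in B\}$. If $A$ is a finite left brace, every Sylow subgroup of its additive group is a left brace under the operations of $A$. *)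

theory Defs
  imports "HOL-Algebra.Ring" "HOL-Computational_Algebra.Primes"
begin

text \<open>
  The signature of a left brace is taken from the record of rings: \<open>\<oplus>\<close> and \<open>\<zero>\<close> are the
  additive structure and \<open>\<otimes>\<close> is the multiplication \<open>a \<cdot> b\<close>.  The field \<open>\<one>\<close> of the record
  plays no role; in particular neither associativity of \<open>\<otimes>\<close> nor a unit is assumed.
\<close>

definition circle_monoid :: "('a, 'm) ring_scheme \<Rightarrow> 'a monoid" where
  "circle_monoid A =
     \<lparr>carrier = carrier A, monoid.mult = (\<lambda>a b. a \<otimes>\<^bsub>A\<^esub> b \<oplus>\<^bsub>A\<^esub> a \<oplus>\<^bsub>A\<^esub> b), one = \<zero>\<^bsub>A\<^esub>\<rparr>"

locale left_brace = abelian_group A for A (structure) +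
  assumes mult_closed: "\<lbrakk>a \<in> carrier A; b \<in> carrier A\<rbrakk> \<Longrightarrow> a \<otimes> b \<in> carrier A"
    and left_distrib:
      "\<lbrakk>a \<in> carrier A; b \<in> carrier A; c \<in> carrier A\<rbrakk>
        \<Longrightarrow> a \<otimes> (b \<oplus> c) = a \<otimes> b \<oplus> a \<otimes> c"
    and circle_group: "group (circle_monoid A)"

definition socle :: "('a, 'm) ring_scheme \<Rightarrow> 'a set" where
  "socle A = {a \<in> carrier A. \<forall>b \<in> carrier A. a \<otimes>\<^bsub>A\<^esub> b = \<zero>\<^bsub>A\<^esub>}"

end

theory Submission
  imports Defs "HOL-Algebra.Multiplicative_Group"
begin

text \<open>
  Write \<open>\<lambda>\<^sub>a(b) = a \<cdot> b + b\<close>, so that \<open>a \<circ> b = a + \<lambda>\<^sub>a(b)\<close>; then \<open>\<lambda>\<close> is an action of the circle group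
  by additive automorphisms, with kernel the socle.  Additive Sylow subgroups are characteristic,
  hence stable under every \<open>\<lambda>\<^sub>a\<close>, and \<open>A\<^sub>m\<close> is a subgroup of the circle group.  For a nonzero
  \<open>a\<close> in the socle of \<open>A\<^sub>m\<close>, the map \<open>\<lambda>\<^sub>a\<close> fixes \<open>A\<^sub>m\<close> pointwise and has \<open>p\<^sub>m\<close>-power order.  On \<open>A\<^sub>j\<close>
  with \<open>j \<noteq> m\<close> the orbits of \<open>\<lambda>\<^sub>a\<close> show that the number of fixed points, which is a power \<open>p\<^sub>j\<^sup>s\<close>,
  is congruent to \<open>|A\<^sub>j|\<close> modulo \<open>p\<^sub>m\<close>; the hypothesis on \<open>p\<^sub>m\<close> forces
  \<open>s = \<alpha>(j)\<close>.  So \<open>\<lambda>\<^sub>a\<close> is the identity on every Sylow subgroup, and \<open>a\<close> lies in the socle of \<open>A\<close>.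
\<close>

section \<open>Coprime divisors, and orbits of a map of prime period\<close>

lemma prod_dvd_if_pairwise_coprime:
  fixes f :: "'i \<Rightarrow> 'b :: semiring_gcd"
  assumes "finite I" "\<And>i. i \<in> I \<Longrightarrow> f i dvd c"
    and "\<And>i j. i \<in> I \<Longrightarrow> j \<in> I \<Longrightarrow> i \<noteq> j \<Longrightarrow> coprime (f i) (f j)"
  shows "prod f I dvd c"
  using assms by (induction I) (auto intro!: divides_mult prod_coprime_right)

lemma funpow_closed:
  assumes "\<And>x. x \<in> B \<Longrightarrow> f x \<in> B" "x \<in> B"
  shows "(f ^^ k) x \<in> B"
  using assms by (induction k) auto

text \<open>The iterates of \<open>f\<close> act on \<open>B\<close> as a cyclic group of prime
  order \<open>q\<close>, so every orbit has 1 or \<open>q\<close> elements, and the moved points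
  are a disjoint union of orbits of size \<open>q\<close>.\<close>

lemma prime_dvd_card_moved:
  assumes "finite B" "prime (q::nat)"
    and closed: "\<And>x. x \<in> B \<Longrightarrow> f x \<in> B"
    and period: "\<And>x. x \<in> B \<Longrightarrow> (f ^^ q) x = x"
  shows "q dvd card {x \<in> B. f x \<noteq> x}"
proof -
  have q: "q > 0" using assms(2) prime_gt_0_nat by blast
  have iter: "(f ^^ k) x \<in> B" if "x \<in> B" for k x
    using funpow_closed[of B f] closed that by blast
  have mult: "(f ^^ (d * k)) x = x" if "(f ^^ d) x = x" for d k x
    using that by (induction k) (auto simp: funpow_add)
  \<comment> \<open>A period \<open>d\<close> strictly between 0 and \<open>q\<close> is coprime to
    \<open>q\<close>; Bezout writes a multiple of \<open>d\<close> as one more than a multiple of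
    \<open>q\<close>, so \<open>f\<close> itself fixes \<open>x\<close>.\<close>
  have fixed: "f x = x" if x: "x \<in> B" and d: "0 < d" "d < q" "(f ^^ d) x = x" for x d
  proof -
    have "coprime d q"
      using d \<open>prime q\<close> by (metis coprime_commute nat_dvd_not_less prime_imp_coprime)
    then obtain u v where uv: "d * u = q * v + 1" using bezout_nat[of d q] d by auto
    have "x = (f ^^ (q * v + 1)) x" using mult[OF d(3)] uv by metis
    also have "\<dots> = f ((f ^^ (q * v)) x)" by simp
    finally show ?thesis using mult[OF period[OF x]] by simp
  qed
  have red: "(f ^^ k) x = (f ^^ (k mod q)) x" if "x \<in> B" for k x
  proof -
    have "(f ^^ (k mod q + q * (k div q))) x = (f ^^ (k mod q)) x"
      unfolding funpow_add comp_apply using mult[OF period[OF that]] by simp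
    then show ?thesis by simp
  qed
  have inverse_iterate: "\<exists>l. (f ^^ l) ((f ^^ k) x) = x" if "x \<in> B" for k x
  proof -
    \<comment> \<open>The exponent \<open>q * k - k\<close> completes \<open>k\<close> to a multiple
      of the period; the subtraction is exact because \<open>q > 0\<close>.\<close>
    have "(f ^^ (q * k - k + k)) x = x" using q mult[OF period[OF that], of k] by simp
    then show ?thesis unfolding funpow_add comp_apply by blast
  qed
  define C where "C = {x \<in> B. f x \<noteq> x}"
  have moved: "(f ^^ k) x \<in> C" if "x \<in> C" for k x
  proof -
    have x: "x \<in> B" "f x \<noteq> x" using that C_def by auto
    have False if fx: "f ((f ^^ k) x) = (f ^^ k) x"
    proof -
      obtain l where l: "(f ^^ l) ((f ^^ k) x) = x" using inverse_iterate x by blast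
      have "(f ^^ l) ((f ^^ k) x) = (f ^^ k) x" using mult[of 1 _ l] fx by simp
      then show False using l fx x by simp
    qed
    then show ?thesis using iter x C_def by auto
  qed
  \<comment> \<open>The orbit relation. Forward iterates suffice for symmetry, since a further
    iterate leads back to the start.\<close>
  define R where "R = {(x, y). x \<in> C \<and> (\<exists>k. y = (f ^^ k) x)}"
  have "equiv C R"
  proof (rule equivI)
    show "R \<subseteq> C \<times> C" using moved by (auto simp: R_def)
    show "refl_on C R"
      unfolding refl_on_def R_def by (auto intro: exI[of _ 0])
    show "sym R"
    proof (rule symI)
      fix x y assume "(x, y) \<in> R"
      then obtain k where k: "x \<in> C" "y = (f ^^ k) x" by (auto simp: R_def)
      then obtain l where "(f ^^ l) y = x" using inverse_iterate[of x k] by (auto simp: C_def)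
      then show "(y, x) \<in> R" using k moved[OF k(1), of k] by (auto simp: R_def intro: sym)
    qed
    show "trans R"
    proof (rule transI)
      fix x y z assume "(x, y) \<in> R" "(y, z) \<in> R"
      then obtain k l where "x \<in> C" "z = (f ^^ (l + k)) x"
        unfolding R_def funpow_add comp_apply by blast
      then show "(x, z) \<in> R" by (auto simp: R_def)
    qed
  qed
  moreover have "q dvd card X" if X: "X \<in> C // R" for X
  proof -
    obtain x where x: "x \<in> C" "X = R `` {x}" using quotientE[OF X] by blast
    have xB: "x \<in> B" using x C_def by auto
    have "X = (\<lambda>k. (f ^^ k) x) ` {..<q}"
    proof (intro equalityI subsetI)
      fix y assume "y \<in> X"
      then obtain k where "y = (f ^^ k) x" using x R_def by auto
      then show "y \<in> (\<lambda>k. (f ^^ k) x) ` {..<q}"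
        using red[OF xB, of k] q by (intro image_eqI[of _ _ "k mod q"]) auto
    qed (use x R_def in auto)
    \<comment> \<open>If two of the first \<open>q\<close> iterates agreed, the earlier one would
      have the period \<open>j - i < q\<close> and would be fixed by \<open>f\<close>, but the orbit
      stays among the moved points.\<close>
    moreover have "inj_on (\<lambda>k. (f ^^ k) x) {..<q}"
    proof (rule linorder_inj_onI')
      fix i j assume ij: "i \<in> {..<q}" "j \<in> {..<q}" "i < j"
      show "(f ^^ i) x \<noteq> (f ^^ j) x"
      proof
        assume "(f ^^ i) x = (f ^^ j) x"
        then have "(f ^^ (j - i)) ((f ^^ i) x) = (f ^^ i) x"
          unfolding comp_apply[of "f ^^ (j - i)", symmetric] funpow_add[symmetric] using ij by simp
        then have "f ((f ^^ i) x) = (f ^^ i) x"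
          using ij by (intro fixed[OF iter[OF xB]]) auto
        then show False using moved[OF x(1), of i] C_def by auto
      qed
    qed
    ultimately show ?thesis by (simp add: card_image)
  qed
  ultimately show ?thesis
    using equiv_imp_dvd_card[of C R q] assms(1) by (simp add: C_def)
qed

section \<open>Endomorphisms of \<open>p\<close>-groups whose period is a power of another
  prime\<close>

context group
begin

lemma subgroup_fixed_points:
  assumes "f \<in> hom G G"
  shows "subgroup {x \<in> carrier G. f x = x} G"
proof -
  interpret group_hom G G f using assms by unfold_locales
  show ?thesis by (rule subgroupI) auto
qed

text \<open>The fixed points form a subgroup of order \<open>p ^ s\<close>, and \<open>q\<close>
  divides the number \<open>p ^ s * (p ^ (e - s) - 1)\<close> of moved points. As \<open>q\<close>
  differs from \<open>p\<close>, it divides the second factor.\<close>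

lemma prime_period_hom_trivial:
  assumes f: "f \<in> hom G G" and card: "card (carrier G) = p ^ e"
    and "prime (p::nat)" "prime (q::nat)" "p \<noteq> q"
    and ndvd: "\<And>i. i \<in> {1..e} \<Longrightarrow> \<not> q dvd p ^ i - 1"
    and period: "\<And>x. x \<in> carrier G \<Longrightarrow> (f ^^ q) x = x"
    and "x \<in> carrier G"
  shows "f x = x"
proof -
  define F where "F = {x \<in> carrier G. f x = x}"
  \<comment> \<open>An infinite set has \<open>card\<close> 0, which is not a power of a
    prime.\<close>
  have fin: "finite (carrier G)"
    using card \<open>prime p\<close> by (metis card.infinite power_not_zero not_prime_0)
  have "card F dvd p ^ e"
    using dvd_triv_right[of "card F" "card (rcosets F)"]
      lagrange[OF subgroup_fixed_points[OF f], folded F_def] card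
    by (simp add: order_def)
  then obtain s where s: "s \<le> e" "card F = p ^ s"
    using \<open>prime p\<close> divides_primepow_nat by blast
  have "q dvd card {x \<in> carrier G. f x \<noteq> x}"
    using prime_dvd_card_moved[OF fin \<open>prime q\<close>, of f] period f by (auto simp: hom_def)
  also have "{x \<in> carrier G. f x \<noteq> x} = carrier G - F" by (auto simp: F_def)
  also have "card \<dots> = p ^ e - p ^ s"
    using fin s card by (subst card_Diff_subset) (auto simp: F_def)
  also have "\<dots> = p ^ s * (p ^ (e - s) - 1)"
    using s by (simp add: diff_mult_distrib2 flip: power_add)
  finally have "q dvd p ^ (e - s) - 1"
    using \<open>prime p\<close> \<open>prime q\<close> \<open>p \<noteq> q\<close>
    by (auto simp: prime_dvd_mult_iff dest: prime_dvd_power primes_dvd_imp_eq)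
  \<comment> \<open>If \<open>s < e\<close>, then \<open>e - s\<close> lies in \<open>{1..e}\<close>
    and \<open>ndvd\<close> applies; for \<open>s = e\<close> the second factor is 0.\<close>
  then have "e = s" using ndvd[of "e - s"] s by force
  then have "F = carrier G"
    using s card fin by (intro card_subset_eq) (auto simp: F_def)
  then show ?thesis using assms(8) F_def by auto
qed

lemma funpow_hom: "f \<in> hom G G \<Longrightarrow> f ^^ k \<in> hom G G"
  by (induction k) (auto simp: hom_def Pi_iff)

text \<open>Induction on \<open>k\<close>: \<open>f ^^ q\<close> has period \<open>q ^ k\<close>,
  hence is trivial, which leaves \<open>f\<close> with the prime period \<open>q\<close>.\<close>

lemma prime_power_period_hom_trivial:
  assumes "f \<in> hom G G" "card (carrier G) = p ^ e"
    and "prime (p::nat)" "prime (q::nat)" "p \<noteq> q"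
    and "\<And>i. i \<in> {1..e} \<Longrightarrow> \<not> q dvd p ^ i - 1"
    and "\<And>x. x \<in> carrier G \<Longrightarrow> (f ^^ (q ^ k)) x = x"
    and "x \<in> carrier G"
  shows "f x = x"
  using assms(1,7,8)
proof (induction k arbitrary: f x)
  case (Suc k)
  have "(f ^^ q) y = y" if "y \<in> carrier G" for y
  proof (rule Suc.IH[of "f ^^ q"])
    show "f ^^ q \<in> hom G G" using Suc.prems funpow_hom by blast
    show "((f ^^ q) ^^ (q ^ k)) z = z" if "z \<in> carrier G" for z
      using Suc.prems(2)[OF that] by (simp add: funpow_mult mult.commute)
  qed (fact that)
  then show ?case
    using prime_period_hom_trivial[of f p e q x] assms Suc.prems by blast
qed simp

end

text \<open>With \<open>r\<close> the index of \<open>H\<close>, the power \<open>x [^] r\<close>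
  vanishes in the quotient and so lies in \<open>H\<close>; coprimality makes \<open>x\<close> a
  power of it. Thus \<open>H\<close> is cut out by an equation that every endomorphism
  preserves.\<close>

lemma (in comm_group) mem_Hall_subgroup:
  assumes H: "subgroup H G" and "finite (carrier G)"
    and cop: "coprime (card H) (card (rcosets H))"
    and x: "x \<in> carrier G" "x [^] card H = \<one>"
  shows "x \<in> H"
proof -
  interpret normal H G using H subgroup_imp_normal by blast
  interpret Q: group "G Mod H" by (rule factorgroup_is_group)
  define r where "r = card (rcosets H)"
  have "H #> x [^] r = (H #> x) [^]\<^bsub>G Mod H\<^esub> r"
    using hom_nat_pow[OF r_coset_hom_Mod x(1)] Q.is_group is_group by auto
  also have "\<dots> = H"
    using Q.pow_order_eq_1[of "H #> x"] x
    by (auto simp: r_def order_def FactGroup_def RCOSETS_def)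
  finally have xr: "x [^] r \<in> H"
    using rcos_self[OF _ is_subgroup, of "x [^] r"] x by simp
  \<comment> \<open>Bezout without subtraction, \<open>r * u = card H * v + 1\<close>, requires a
    nonzero \<open>r\<close>.\<close>
  have "r \<noteq> 0"
    using lagrange[OF H] assms(2) by (metis mult_zero_left order_gt_0_iff_finite r_def less_irrefl)
  then obtain u v where "r * u = card H * v + 1"
    using bezout_nat[of r "card H"] cop by (auto simp: r_def coprime_commute)
  then have "(x [^] r) [^] u = (x [^] card H) [^] v \<otimes> x"
    using x by (metis nat_pow_pow nat_pow_mult nat_pow_closed nat_pow_eone)
  then have "x = (x [^] r) [^] u" using x by simp
  moreover have "(x [^] r) [^] u \<in> H"
    using xr H by (induction u) (auto simp: subgroup.m_closed)
  ultimately show ?thesis by simp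
qed

section \<open>The action \<open>lam\<close> of the circle group on the additive group\<close>

context left_brace
begin

definition lam :: "'a \<Rightarrow> 'a \<Rightarrow> 'a" where
  "lam a b = a \<otimes> b \<oplus> b"

abbreviation circ :: "'a \<Rightarrow> 'a \<Rightarrow> 'a" where
  "circ a b \<equiv> a \<otimes>\<^bsub>circle_monoid A\<^esub> b"

lemma circle_simps [simp]:
  "carrier (circle_monoid A) = carrier A"
  "\<one>\<^bsub>circle_monoid A\<^esub> = \<zero>"
  by (simp_all add: circle_monoid_def)

lemma lam_closed [simp]: "a \<in> carrier A \<Longrightarrow> b \<in> carrier A \<Longrightarrow> lam a b \<in> carrier A"
  by (simp add: lam_def mult_closed)

lemma circ_eq: "a \<in> carrier A \<Longrightarrow> b \<in> carrier A \<Longrightarrow> circ a b = a \<oplus> lam a b"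
  by (simp add: circle_monoid_def lam_def mult_closed a_ac)

lemma lam_add:
  "a \<in> carrier A \<Longrightarrow> b \<in> carrier A \<Longrightarrow> c \<in> carrier A \<Longrightarrow> lam a (b \<oplus> c) = lam a b \<oplus> lam a c"
  by (simp add: lam_def left_distrib mult_closed a_ac)

lemma lam_hom: "a \<in> carrier A \<Longrightarrow> lam a \<in> hom (add_monoid A) (add_monoid A)"
  by (simp add: hom_def lam_add)

text \<open>Added to \<open>circ a b\<close>, both sides give \<open>circ a (circ b c)\<close> by
  associativity of the circle operation; cancel in the additive group.\<close>

lemma lam_circ:
  assumes "a \<in> carrier A" "b \<in> carrier A" "c \<in> carrier A"
  shows "lam (circ a b) c = lam a (lam b c)"
proof -
  interpret C: group "circle_monoid A" by (rule circle_group)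
  have ab: "circ a b \<in> carrier A" using C.m_closed assms by simp
  have "circ a b \<oplus> lam (circ a b) c = circ a (circ b c)"
    using C.m_assoc[of a b c] assms ab by (simp add: circ_eq)
  also have "\<dots> = circ a b \<oplus> lam a (lam b c)"
    using assms by (simp add: circ_eq lam_add a_assoc)
  finally show ?thesis using assms ab by simp
qed

lemma lam_zero: "b \<in> carrier A \<Longrightarrow> lam \<zero> b = b"
proof -
  interpret C: group "circle_monoid A" by (rule circle_group)
  assume b: "b \<in> carrier A"
  then show ?thesis using C.l_one[of b] circ_eq[of \<zero> b] by simp
qed

text \<open>Turns a bound on the circle order of \<open>a\<close> into a period of the map
  \<open>lam a\<close>.\<close>

lemma lam_pow:
  fixes k :: nat
  assumes "a \<in> carrier A" "b \<in> carrier A"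
  shows "lam (a [^]\<^bsub>circle_monoid A\<^esub> k) b = (lam a ^^ k) b"
  using assms(2)
proof (induction k arbitrary: b)
  case 0
  then show ?case by (simp add: lam_zero)
next
  case (Suc k)
  interpret C: group "circle_monoid A" by (rule circle_group)
  have "a [^]\<^bsub>circle_monoid A\<^esub> k \<in> carrier A" using C.nat_pow_closed[of a k] assms by simp
  then show ?case using Suc assms by (simp add: lam_circ funpow_Suc_right del: funpow.simps)
qed

lemma mult_eq_zero_iff:
  assumes "a \<in> carrier A" "b \<in> carrier A"
  shows "a \<otimes> b = \<zero> \<longleftrightarrow> lam a b = b"
  using assms mult_closed by (simp add: lam_def)

text \<open>Circle products and circle inverses can be written with the additive operations and
  \<open>lam\<close>, under which \<open>H\<close> is closed.\<close>

lemma subgroup_circle: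
  assumes H: "subgroup H (add_monoid A)"
    and stable: "\<And>a b. a \<in> carrier A \<Longrightarrow> b \<in> H \<Longrightarrow> lam a b \<in> H"
  shows "subgroup H (circle_monoid A)"
proof -
  interpret C: group "circle_monoid A" by (rule circle_group)
  interpret H: subgroup H "add_monoid A" by (rule H)
  have sub: "a \<in> carrier A" if "a \<in> H" for a using H.subset that by auto
  show ?thesis
  proof (rule C.subgroupI)
    show "H \<subseteq> carrier (circle_monoid A)" "H \<noteq> {}"
      using sub H.one_closed by auto
  next
    fix a b assume "a \<in> H" "b \<in> H"
    then show "circ a b \<in> H"
      using sub stable H.m_closed by (simp add: circ_eq)
  next
    fix a assume a: "a \<in> H"
    define b where "b = inv\<^bsub>circle_monoid A\<^esub> a"
    have b: "b \<in> carrier A" using a sub C.inv_closed b_def by simp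
    \<comment> \<open>The left inverse law is the useful one: it yields \<open>b\<close> as the
      negative of \<open>lam b a\<close>, and stability applies because \<open>a\<close> lies in
      \<open>H\<close>, while \<open>b\<close> is only known to lie in the carrier.\<close>
    have "circ b a = \<zero>" using a sub by (simp add: b_def)
    then have "b \<oplus> lam b a = \<zero>" using circ_eq[OF b] a sub by simp
    then have "b = \<ominus> lam b a" using a b sub by (metis lam_closed minus_equality)
    then show "b \<in> H"
      using H.m_inv_closed[OF stable[OF b a]] by (simp add: a_inv_def)
  qed
qed

text \<open>Elements of \<open>H\<close> are killed by \<open>card H\<close>, the additive map
  \<open>lam a\<close> preserves this, and a Hall subgroup contains every such element.\<close>

lemma lam_stable_Hall_subgroup:
  assumes H: "subgroup H (add_monoid A)" and "finite (carrier A)"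
    and "coprime (card H) (card (rcosets\<^bsub>add_monoid A\<^esub> H))"
    and "a \<in> carrier A" "b \<in> H"
  shows "lam a b \<in> H"
proof -
  interpret H: group "add_monoid A\<lparr>carrier := H\<rparr>" using H by (rule group.subgroup_imp_group[OF a_group])
  have b: "b \<in> carrier A" using subgroup.subset[OF H] assms by auto
  have "b [^]\<^bsub>add_monoid A\<^esub> card H = \<one>\<^bsub>add_monoid A\<^esub>"
    using H.pow_order_eq_1[of b] assms(5) by (simp add: order_def nat_pow_def)
  moreover have "lam a b [^]\<^bsub>add_monoid A\<^esub> card H = lam a (b [^]\<^bsub>add_monoid A\<^esub> card H)"
    using hom_nat_pow[OF lam_hom[OF assms(4)], of b] b a_group by simp
  moreover have "lam a \<one>\<^bsub>add_monoid A\<^esub> = \<one>\<^bsub>add_monoid A\<^esub>"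
    using hom_one[OF lam_hom[OF assms(4)]] a_group by simp
  ultimately show ?thesis
    using comm_group.mem_Hall_subgroup[OF a_comm_group H] assms b by simp
qed

end

section \<open>A socle element of one Sylow subgroup acting on all of them\<close>

theorem corollary7:
  fixes A :: "('a, 'm) ring_scheme"
    and n m :: nat
    and p \<alpha> :: "nat \<Rightarrow> nat"
    and S :: "nat \<Rightarrow> 'a set"
  assumes "left_brace A"
    and "\<And>i. i \<in> {1..n} \<Longrightarrow> prime (p i)"
    and "strict_mono_on {1..n} p"
    and "\<And>i. i \<in> {1..n} \<Longrightarrow> \<alpha> i > 0"
    and "card (carrier A) = (\<Prod>i = 1..n. p i ^ \<alpha> i)"
    and "\<And>i. i \<in> {1..n} \<Longrightarrow> subgroup (S i) (add_monoid A) \<and> card (S i) = p i ^ \<alpha> i"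
    and "m \<in> {1..n}"
    and "socle (A\<lparr>carrier := S m\<rparr>) \<noteq> {\<zero>\<^bsub>A\<^esub>}"
    and "\<And>j i. \<lbrakk>j \<in> {1..n}; i \<in> {1..\<alpha> j}\<rbrakk> \<Longrightarrow> \<not> p m dvd p j ^ i - 1"
  shows "socle A \<noteq> {\<zero>\<^bsub>A\<^esub>}"
proof -
  interpret left_brace A by fact
  interpret C: group "circle_monoid A" by (rule circle_group)
  have S: "subgroup (S i) (add_monoid A)" "card (S i) = p i ^ \<alpha> i" if "i \<in> {1..n}" for i
    using assms(6) that by auto
  have sub: "x \<in> carrier A" if "i \<in> {1..n}" "x \<in> S i" for i x
    using subgroup.subset[OF S(1)] that by auto
  \<comment> \<open>Finiteness of \<open>A\<close> comes from the cardinality formula, since an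
    infinite carrier would have \<open>card\<close> 0.\<close>
  have card_pos: "card (carrier A) \<noteq> 0"
    using assms(2) by (auto simp: assms(5) prime_gt_0_nat dest!: assms(2))
  then have fin: "finite (carrier A)" by (metis card.infinite)
  have p_neq: "p i \<noteq> p j" if "i \<in> {1..n}" "j \<in> {1..n}" "i \<noteq> j" for i j
    using strict_mono_on_imp_inj_on[OF assms(3)] that by (meson inj_on_def)
  have cop: "coprime (p i ^ \<alpha> i) (p j ^ \<alpha> j)" if "i \<in> {1..n}" "j \<in> {1..n}" "i \<noteq> j" for i j
    using p_neq[OF that] assms(2) that
    by (metis coprime_power_left_iff coprime_power_right_iff primes_coprime)
  have stable: "lam a b \<in> S j" if j: "j \<in> {1..n}" and "a \<in> carrier A" "b \<in> S j" for a b j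
  proof (rule lam_stable_Hall_subgroup[OF S(1)[OF j] fin])
    \<comment> \<open>Cancelling \<open>p j ^ \<alpha> j\<close> in Lagrange's theorem leaves the
      other prime powers as the index, so \<open>S j\<close> is a Hall subgroup.\<close>
    have "card (rcosets\<^bsub>add_monoid A\<^esub> S j) * p j ^ \<alpha> j = (\<Prod>i\<in>{1..n} - {j}. p i ^ \<alpha> i) * p j ^ \<alpha> j"
      using group.lagrange[OF a_group S(1)[OF j]] S(2)[OF j] assms(5) j
        prod.remove[of "{1..n}" j "\<lambda>i. p i ^ \<alpha> i"]
      by (simp add: order_def mult.commute)
    then have index: "card (rcosets\<^bsub>add_monoid A\<^esub> S j) = (\<Prod>i\<in>{1..n} - {j}. p i ^ \<alpha> i)"
      using assms(2)[OF j] by (simp add: prime_gt_0_nat)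
    show "coprime (card (S j)) (card (rcosets\<^bsub>add_monoid A\<^esub> S j))"
      unfolding S(2)[OF j] index using cop[OF j] by (intro prod_coprime_right) auto
  qed (use that in auto)

  \<comment> \<open>The socle of \<open>S m\<close> is nonempty, so differing from the zero set
    gives it a nonzero element.\<close>
  have "\<zero>\<^bsub>A\<^esub> \<in> socle (A\<lparr>carrier := S m\<rparr>)"
    using subgroup.one_closed[OF S(1)[OF assms(7)]] lam_zero sub[OF assms(7)]
    by (simp add: socle_def mult_eq_zero_iff)
  then obtain a where a: "a \<in> socle (A\<lparr>carrier := S m\<rparr>)" "a \<noteq> \<zero>\<^bsub>A\<^esub>"
    using assms(8) by blast
  then have aS: "a \<in> S m" and triv: "\<And>b. b \<in> S m \<Longrightarrow> lam a b = b"
    using sub[OF assms(7)] by (auto simp: socle_def mult_eq_zero_iff)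
  have aA: "a \<in> carrier A" using aS sub assms(7) by blast

  \<comment> \<open>As \<open>S m\<close> is also a circle subgroup, its order, a power of
    \<open>p m\<close>, annihilates \<open>a\<close> there.\<close>
  interpret Cm: group "circle_monoid A\<lparr>carrier := S m\<rparr>"
    using subgroup_circle[OF S(1)[OF assms(7)]] stable assms(7) by (blast intro: C.subgroup_imp_group)
  have "a [^]\<^bsub>circle_monoid A\<^esub> (p m ^ \<alpha> m) = \<zero>\<^bsub>A\<^esub>"
    using Cm.pow_order_eq_1[of a] aS S(2)[OF assms(7)] by (simp add: order_def nat_pow_def)
  then have period: "(lam a ^^ (p m ^ \<alpha> m)) b = b" if "b \<in> carrier A" for b
    using lam_pow[OF aA that, of "p m ^ \<alpha> m"] lam_zero that by simp

  have fixes_S: "lam a b = b" if j: "j \<in> {1..n}" and b: "b \<in> S j" for j b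
  \<comment> \<open>The counting argument needs distinct primes; for \<open>j = m\<close> the choice
    of \<open>a\<close> in the socle of \<open>S m\<close> gives the claim.\<close>
  proof (cases "j = m")
    case False
    interpret Sj: group "add_monoid A\<lparr>carrier := S j\<rparr>"
      using S(1)[OF j] by (rule group.subgroup_imp_group[OF a_group])
    show ?thesis
    proof (rule Sj.prime_power_period_hom_trivial)
      show "lam a \<in> hom (add_monoid A\<lparr>carrier := S j\<rparr>) (add_monoid A\<lparr>carrier := S j\<rparr>)"
        using stable[OF j aA] lam_add[OF aA] sub[OF j] by (auto simp: hom_def)
      show "(lam a ^^ (p m ^ \<alpha> m)) x = x" if "x \<in> carrier (add_monoid A\<lparr>carrier := S j\<rparr>)" for x
        using period sub[OF j] that by simp
      show "p j \<noteq> p m" using p_neq j assms(7) False by blast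
    qed (use S j b assms(2,7,9) in auto)
  qed (use triv b in auto)

  \<comment> \<open>The fixed subgroup contains every \<open>S j\<close>, so its order is divisible
    by the pairwise coprime \<open>p j ^ \<alpha> j\<close> and hence by their product, the order of
    \<open>A\<close>.\<close>
  define F where "F = {b \<in> carrier A. lam a b = b}"
  have F: "subgroup F (add_monoid A)"
    using group.subgroup_fixed_points[OF a_group lam_hom[OF aA]] by (simp add: F_def)
  have "p j ^ \<alpha> j dvd card F" if j: "j \<in> {1..n}" for j
  proof -
    interpret F: group "add_monoid A\<lparr>carrier := F\<rparr>" using F by (rule group.subgroup_imp_group[OF a_group])
    have "S j \<subseteq> F" using fixes_S j sub by (auto simp: F_def)
    then have "subgroup (S j) (add_monoid A\<lparr>carrier := F\<rparr>)"
      using group.subgroup_incl[OF a_group S(1)[OF j] F] by blast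
    then show ?thesis
      using F.lagrange S(2)[OF j]
      by (metis dvd_triv_right order_def partial_object.simps(1) partial_object.update_convs(1))
  qed
  then have "(\<Prod>i = 1..n. p i ^ \<alpha> i) dvd card F"
    using cop by (intro prod_dvd_if_pairwise_coprime) auto
  then have "card (carrier A) dvd card F" by (simp add: assms(5))
  moreover have FA: "F \<subseteq> carrier A" by (auto simp: F_def)
  \<comment> \<open>Divisibility bounds \<open>card (carrier A)\<close> by \<open>card F\<close>
    only when the latter is nonzero.\<close>
  moreover have "card F \<noteq> 0"
    using subgroup.one_closed[OF F] finite_subset[OF FA fin] by auto
  ultimately have "F = carrier A"
    using fin by (intro card_seteq) (auto intro: dvd_imp_le)
  then have "a \<in> socle A" using aA by (auto simp: socle_def F_def mult_eq_zero_iff)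
  then show ?thesis using a by blast
qed

end
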